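(* Let $n \ge 1$, let $p_k$ denote the $k$th prime ($p_1 = 2$, $p_2 = 3$, \dots), and for each $k \in [n]$ let $S_k = [p_{k+1}] = \{1,\dots,p_{k+1}\}$. Let $Q = S_1 \times \cdots \times S_n$. Then any collection of hyperplanes in $Q$ (each with a non-empty set of fixed coordinates) whose union is $Q$ contains two distinct parallel hyperplanes.
   Context: For finite sets $S_1,\dots,S_n$, a hyperplane in $Q = S_1\times\cdots\times S_n$ is a set $A = A_1\times\cdots\times A_n$ where each $A_k$ is either $S_k$ or a singleton subset of $S_k$. Its set of fixed coordinates is $F(A) = \{k : A_k \ne S_k\}$ (i.e. $A_k$ is a singleton). Two hyperplanes $A, A'$ are parallel if $F(A) = F(A')$. *)

theory Defs
  imports "HOL-Computational_Algebra.Primes" "HOL-Library.Infinite_Set" "HOL-Library.FuncSet"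
begin

(* p_k = the k-th prime, 1-indexed: p_1 = 2, p_2 = 3, ... ; enumerate is 0-indexed *)
definition nth_prime :: "nat \<Rightarrow> nat" where
  "nth_prime k = enumerate {p::nat. prime p} (k - 1)"

definition S :: "nat \<Rightarrow> nat set" where
  "S k = {1..nth_prime (k + 1)}"

definition Q :: "nat \<Rightarrow> (nat \<Rightarrow> nat) set" where
  "Q n = PiE {1..n} S"

definition hyperplane :: "nat \<Rightarrow> (nat \<Rightarrow> nat) set \<Rightarrow> bool" where
  "hyperplane n A \<longleftrightarrow> (\<exists>C :: nat \<Rightarrow> nat set.
      (\<forall>k\<in>{1..n}. C k = S k \<or> (\<exists>c\<in>S k. C k = {c})) \<and> A = PiE {1..n} C)"

(* F(A) = {k : A_k \<noteq> S_k}; the k-th factor A_k of a (nonempty) product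
   is the projection of A onto coordinate k *)
definition fixed_coords :: "nat \<Rightarrow> (nat \<Rightarrow> nat) set \<Rightarrow> nat set" where
  "fixed_coords n A = {k\<in>{1..n}. (\<lambda>x. x k) ` A \<noteq> S k}"

definition parallel :: "nat \<Rightarrow> (nat \<Rightarrow> nat) set \<Rightarrow> (nat \<Rightarrow> nat) set \<Rightarrow> bool" where
  "parallel n A B \<longleftrightarrow> fixed_coords n A = fixed_coords n B"

end

theory Submission
  imports Defs Complex_Main
begin

text \<open>
  Suppose that no two hyperplanes are parallel, so that there is at most one hyperplane for every
  set \<open>F\<close> of fixed coordinates. Deleting from each \<open>S k\<close> the value fixed by the hyperplane
  with \<open>F = {k}\<close> leaves sides of length \<open>r k = p - 1\<close>. By the distortion method a random point
  is built coordinate by coordinate. Given the first \<open>k - 1\<close> coordinates, let \<open>N\<close> be the number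
  of values of the next one that complete a hyperplane with maximal fixed coordinate \<open>k\<close>. These
  values get as little mass as possible under the constraint that no value gets more than
  \<open>w k = 1 / (r k - c k)\<close>; they then have mass \<open>max 0 (N - c k) * w k\<close>.

  The point is that the expectation of a convex increasing function of \<open>N\<close> has an exact worst case.
  Since all conditional probabilities of coordinate \<open>i\<close> are at most \<open>w i\<close>, it is largest when the
  fixed values are nested, where \<open>N + 1 = 2 ^ J\<close> with \<open>J\<close> a sum of independent Bernoulli variables
  with parameters \<open>w i\<close>. With \<open>c k = r k div 4\<close> the total mass of all hyperplanes is bounded by
  \<open>0.517\<close> for the primes up to \<open>4096\<close>, by tracking the distribution of \<open>J\<close>, and by \<open>0.37\<close> for the
  remaining ones, by the second moment of \<open>2 ^ J\<close> and Chebyshev's bound for the number of primes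
  in \<open>(2 ^ m, 2 ^ (m + 1)]\<close>. As this is less than \<open>1\<close>, some point is not covered.
\<close>

section \<open>The distortion method\<close>

text \<open>The distortion on one side \<open>U\<close>: \<open>X\<close> holds the values to avoid,
  and \<open>1 / (card U - c)\<close> is the cap on every value. If \<open>card X \<le> c\<close>,
  the other values can carry all the mass below the cap; otherwise they are filled to the cap and
  \<open>X\<close> shares the remainder equally.\<close>

definition spread :: "nat set \<Rightarrow> nat set \<Rightarrow> nat \<Rightarrow> nat \<Rightarrow> real" where
  "spread X U c y =
     (if card X \<le> c then (if y \<in> X then 0 else 1 / real (card U - card X))
      else (if y \<in> X then real (card X - c) / (real (card X) * real (card U - c))
            else 1 / real (card U - c)))"

context
  fixes X U :: "nat set" and c :: nat
  assumes U: "finite U" and XU: "X \<subseteq> U" and c: "c < card U"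
begin

private lemma split_sum: "sum f U = sum f X + sum f (U - X)" for f :: "nat \<Rightarrow> real"
  using U XU by (metis add.commute sum.subset_diff)

lemma spread_nonneg: "0 \<le> spread X U c y"
  by (simp add: spread_def)

lemma spread_blocked: "(\<Sum>y\<in>X. spread X U c y) = max 0 (real (card X) - real c) / real (card U - c)"
proof (cases "card X \<le> c")
  case False
  then have "card X \<noteq> 0" by simp
  with False show ?thesis
    by (auto simp: spread_def of_nat_diff divide_simps)
qed (simp add: spread_def)

lemma spread_sum: "(\<Sum>y\<in>U. spread X U c y) = 1"
proof -
  have cd: "card (U - X) = card U - card X" and le: "card X \<le> card U"
    using U XU by (auto simp: card_Diff_subset finite_subset card_mono)
  have "(\<Sum>y\<in>U - X. spread X U c y)
      = (if card X \<le> c then 1 else real (card U - card X) / real (card U - c))"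
    using c cd le by (auto simp: spread_def)
  then show ?thesis
    unfolding split_sum spread_blocked using c le by (auto simp: of_nat_diff divide_simps)
qed

lemma spread_le: "y \<in> U \<Longrightarrow> spread X U c y \<le> 1 / real (card U - c)"
proof (cases "card X \<le> c")
  case True
  then show ?thesis using c by (auto simp: spread_def intro!: frac_le)
next
  case False
  then have "real (card X - c) / real (card X) * (1 / real (card U - c)) \<le> 1 * (1 / real (card U - c))"
    by (intro mult_right_mono) auto
  then show ?thesis using False by (simp add: spread_def)
qed

end

text \<open>The expectation of \<open>f (t * 2 ^ J)\<close> where \<open>J\<close> is the sum of \<open>k\<close> independent Bernoulli variables
  with parameters \<open>w 1, \<dots>, w k\<close>.\<close>

fun doubling_mean :: "(nat \<Rightarrow> real) \<Rightarrow> nat \<Rightarrow> (nat \<Rightarrow> real) \<Rightarrow> nat \<Rightarrow> real" where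
  "doubling_mean w 0 f t = f t"
| "doubling_mean w (Suc k) f t = (1 - w (Suc k)) * doubling_mean w k f t + w (Suc k) * doubling_mean w k f (2 * t)"

section \<open>Counting the index sets on which a point agrees with a family\<close>

text \<open>The empty set always counts, so for the family lifted to coordinate \<open>k + 1\<close>
  this plays the role of \<open>N + 1\<close> rather than \<open>N\<close>.\<close>

definition matches :: "nat \<Rightarrow> (nat set \<Rightarrow> nat \<Rightarrow> nat) \<Rightarrow> (nat \<Rightarrow> nat) \<Rightarrow> nat" where
  "matches k b x = card {G. G \<subseteq> {1..k} \<and> (\<forall>i\<in>G. x i = b G i)}"

definition lift_family :: "nat \<Rightarrow> (nat set \<Rightarrow> nat \<Rightarrow> nat) \<Rightarrow> nat set \<Rightarrow> nat \<Rightarrow> nat" where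
  "lift_family k b G = b (insert k G)"

definition lift_matches :: "nat \<Rightarrow> (nat set \<Rightarrow> nat \<Rightarrow> nat) \<Rightarrow> (nat \<Rightarrow> nat) \<Rightarrow> nat \<Rightarrow> nat" where
  "lift_matches k b x y = card {G. G \<subseteq> {1..k} \<and> (\<forall>i\<in>G. x i = lift_family (Suc k) b G i)
     \<and> y = lift_family (Suc k) b G (Suc k)}"

lemma matches_Suc:
  "matches (Suc k) b (x(Suc k := y)) = matches k b x + lift_matches k b x y"
proof -
  let ?P = "\<lambda>G. \<forall>i\<in>G. (x(Suc k := y)) i = b G i"
  let ?A = "{G. G \<subseteq> {1..k} \<and> (\<forall>i\<in>G. x i = b G i)}"
  let ?B = "{G. G \<subseteq> {1..k} \<and> (\<forall>i\<in>G. x i = lift_family (Suc k) b G i)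
     \<and> y = lift_family (Suc k) b G (Suc k)}"
  have eq: "{G. G \<subseteq> {1..Suc k} \<and> ?P G} = ?A \<union> insert (Suc k) ` ?B"
  proof (intro set_eqI iffI)
    fix G assume G: "G \<in> {G. G \<subseteq> {1..Suc k} \<and> ?P G}"
    show "G \<in> ?A \<union> insert (Suc k) ` ?B"
    proof (cases "Suc k \<in> G")
      case True
      let ?G = "G - {Suc k}"
      have ins: "insert (Suc k) ?G = G" using True by auto
      have "?G \<subseteq> {1..k}" using G by (auto simp: atLeastAtMostSuc_conv)
      moreover have "\<forall>i\<in>?G. x i = b G i"
      proof
        fix i assume "i \<in> ?G"
        then have "(x(Suc k := y)) i = b G i" "i \<noteq> Suc k" using G by blast+
        then show "x i = b G i" by simp
      qed
      moreover have "y = b G (Suc k)" using G True by force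
      ultimately have "?G \<in> ?B" by (simp add: lift_family_def insert_absorb[OF True])
      with ins show ?thesis by blast
    next
      case False
      then have "G \<subseteq> {1..k}" using G by (auto simp: atLeastAtMostSuc_conv)
      moreover have "x i = b G i" if "i \<in> G" for i
      proof -
        have "i \<noteq> Suc k" using False that by auto
        moreover have "(x(Suc k := y)) i = b G i" using G that by blast
        ultimately show ?thesis by simp
      qed
      ultimately show ?thesis by auto
    qed
  next
    fix G assume "G \<in> ?A \<union> insert (Suc k) ` ?B"
    then show "G \<in> {G. G \<subseteq> {1..Suc k} \<and> ?P G}"
      by (fastforce simp: lift_family_def)
  qed
  have fin: "finite ?A" "finite ?B"
    by (rule finite_subset[of _ "Pow {1..k}"]; auto)+
  have inj: "inj_on (insert (Suc k)) ?B"
  proof (rule inj_onI)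
    fix G G' assume "G \<in> ?B" "G' \<in> ?B" "insert (Suc k) G = insert (Suc k) G'"
    moreover from this have "Suc k \<notin> G" "Suc k \<notin> G'" by auto
    ultimately show "G = G'" by (metis insert_ident)
  qed
  have "?A \<inter> insert (Suc k) ` ?B = {}" by auto
  with fin inj show ?thesis
    unfolding matches_def lift_matches_def eq by (simp add: card_Un_disjoint card_image)
qed

text \<open>Each \<open>G\<close> prescribes just one value of the last coordinate, so the sets
  counted for different \<open>y\<close> are disjoint.\<close>

lemma sum_lift_matches_le:
  assumes "finite U"
  shows "(\<Sum>y\<in>U. lift_matches k b x y) \<le> matches k (lift_family (Suc k) b) x"
proof -
  let ?M = "{G. G \<subseteq> {1..k} \<and> (\<forall>i\<in>G. x i = lift_family (Suc k) b G i)}"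
  have fin: "finite ?M" by (rule finite_subset[of _ "Pow {1..k}"]) auto
  have "(\<Sum>y\<in>U. lift_matches k b x y)
      = (\<Sum>y\<in>U. card {G \<in> ?M. y = lift_family (Suc k) b G (Suc k)})"
    by (simp add: lift_matches_def conj_assoc)
  also have "\<dots> = card (\<Union>y\<in>U. {G \<in> ?M. y = lift_family (Suc k) b G (Suc k)})"
    by (subst card_UN_disjoint) (use assms fin in auto)
  also have "\<dots> \<le> card ?M" by (rule card_mono[OF fin]) auto
  finally show ?thesis by (simp add: matches_def)
qed

section \<open>Discrete convexity and the extremal average\<close>

text \<open>Convexity on the naturals as monotonicity of chord slopes from \<open>u\<close>,
  multiplied out to avoid division by \<open>c\<close> and \<open>d\<close>.\<close>

definition convex_incr :: "(nat \<Rightarrow> real) \<Rightarrow> bool" where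
  "convex_incr f \<longleftrightarrow> mono f \<and>
     (\<forall>u c d. c \<le> d \<longrightarrow> real d * (f (u + c) - f u) \<le> real c * (f (u + d) - f u))"

lemma convex_incr_max: "convex_incr (\<lambda>u. max 0 (real u - s))"
  unfolding convex_incr_def
proof (intro conjI allI impI)
  show "mono (\<lambda>u. max 0 (real u - s))" by (auto simp: mono_def)
  fix u c d :: nat assume cd: "c \<le> d"
  show "real d * (max 0 (real (u + c) - s) - max 0 (real u - s))
      \<le> real c * (max 0 (real (u + d) - s) - max 0 (real u - s))"
  proof (cases "real u \<ge> s")
    case True then show ?thesis by (simp add: max_def)
  next
    case F: False
    show ?thesis
    proof (cases "real (u + c) \<ge> s")
      case True
      \<comment> \<open>This product is the difference of the two sides of the goal, in which the
        terms \<open>c * d\<close> cancel.\<close>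
      have "0 \<le> (real d - real c) * (s - real u)"
        using cd F by (intro mult_nonneg_nonneg) auto
      then show ?thesis using True F cd by (simp add: max_def algebra_simps)
    next
      case False
      then show ?thesis using F cd by (simp add: max_def)
    qed
  qed
qed

text \<open>On \<open>{N..N + M}\<close> the function lies below its chord, and the cap gives
  \<open>m\<close> an average of at most \<open>w * M\<close>. The right-hand side is the case where
  a single value of mass \<open>w\<close> carries all of \<open>M\<close>.\<close>

lemma average_convex_incr:
  fixes K :: "nat \<Rightarrow> real" and m :: "nat \<Rightarrow> nat"
  assumes f: "convex_incr f" and U: "finite U"
    and K: "\<And>y. y \<in> U \<Longrightarrow> 0 \<le> K y" "\<And>y. y \<in> U \<Longrightarrow> K y \<le> w" "sum K U = 1"
    and m: "(\<Sum>y\<in>U. m y) \<le> M"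
  shows "(\<Sum>y\<in>U. K y * f (N + m y)) \<le> (1 - w) * f N + w * f (N + M)"
proof -
  define D where "D = f (N + M) - f N"
  have D: "0 \<le> D" using f by (auto simp: D_def convex_incr_def mono_def)
  have mM: "m y \<le> M" if "y \<in> U" for y
    using member_le_sum[of y U m] U m that by simp
  show ?thesis
  proof (cases "M = 0")
    case True
    then have "(\<Sum>y\<in>U. K y * f (N + m y)) = (\<Sum>y\<in>U. K y * f N)"
      using mM by (intro sum.cong) auto
    also have "\<dots> = f N" using K(3) by (simp flip: sum_distrib_right)
    finally show ?thesis using True by (simp add: algebra_simps)
  next
    case False
    have "U \<noteq> {}" using K(3) by auto
    then have w: "0 \<le> w" using K(1,2) by (meson ex_in_conv order_trans)
    have f_le: "f (N + m y) \<le> f N + real (m y) * (D / M)" if "y \<in> U" for y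
    proof -
      have "real M * (f (N + m y) - f N) \<le> real (m y) * D"
        using f mM[OF that] by (auto simp: convex_incr_def D_def)
      with False show ?thesis by (simp add: field_simps)
    qed
    have "(\<Sum>y\<in>U. K y * real (m y)) \<le> (\<Sum>y\<in>U. w * real (m y))"
      using K(2) by (intro sum_mono mult_right_mono) auto
    also have "\<dots> = w * real (\<Sum>y\<in>U. m y)" by (simp add: sum_distrib_left)
    also have "\<dots> \<le> w * real M"
      using w m by (intro mult_left_mono) linarith+
    finally have mass: "(\<Sum>y\<in>U. K y * real (m y)) \<le> w * real M" .
    have "(\<Sum>y\<in>U. K y * f (N + m y)) \<le> (\<Sum>y\<in>U. K y * (f N + real (m y) * (D / M)))"
      using K(1) f_le by (intro sum_mono mult_left_mono) auto
    also have "\<dots> = (\<Sum>y\<in>U. K y * f N) + (\<Sum>y\<in>U. K y * real (m y) * (D / M))"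
      by (simp add: distrib_left sum.distrib mult.assoc)
    also have "\<dots> = (\<Sum>y\<in>U. K y) * f N + (\<Sum>y\<in>U. K y * real (m y)) * (D / M)"
      by (simp only: sum_distrib_right)
    also have "\<dots> \<le> f N + w * real M * (D / M)"
      using D mass K(3) by (intro add_mono mult_right_mono) auto
    also have "\<dots> = (1 - w) * f N + w * f (N + M)"
    proof -
      have "w * real M * (D / M) = w * D" using False by simp
      then show ?thesis by (simp add: D_def algebra_simps)
    qed
    finally show ?thesis .
  qed
qed

section \<open>Sampling a point coordinate by coordinate\<close>

locale sampling =
  fixes T :: "nat \<Rightarrow> nat set" and K :: "nat \<Rightarrow> (nat \<Rightarrow> nat) \<Rightarrow> nat \<Rightarrow> real" and w :: "nat \<Rightarrow> real"
  assumes fin: "finite (T k)"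
    and K_nonneg: "y \<in> T k \<Longrightarrow> 0 \<le> K k x y"
    and K_le: "y \<in> T k \<Longrightarrow> K k x y \<le> w k"
    and K_sum: "(\<Sum>y\<in>T k. K k x y) = 1"
begin

text \<open>The expectation when coordinate \<open>k\<close> is drawn with conditional weights
  \<open>K k x\<close> given the earlier coordinates of \<open>x\<close>. Starting from the constant
  \<open>undefined\<close> makes the sampled points extensional, hence members of
  \<open>PiE {1..k} T\<close>.\<close>

fun E :: "nat \<Rightarrow> ((nat \<Rightarrow> nat) \<Rightarrow> real) \<Rightarrow> real" where
  "E 0 g = g (\<lambda>_. undefined)"
| "E (Suc k) g = E k (\<lambda>x. \<Sum>y\<in>T (Suc k). K (Suc k) x y * g (x(Suc k := y)))"

lemma E_mono: "(\<And>x. g x \<le> h x) \<Longrightarrow> E k g \<le> E k h"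
proof (induction k arbitrary: g h)
  case (Suc k)
  show ?case
    unfolding E.simps by (intro Suc.IH sum_mono mult_left_mono K_nonneg Suc.prems)
qed simp

lemma E_linear: "E k (\<lambda>x. \<alpha> * g x + \<beta> * h x) = \<alpha> * E k g + \<beta> * E k h"
proof (induction k arbitrary: g h)
  case (Suc k)
  have "E (Suc k) (\<lambda>x. \<alpha> * g x + \<beta> * h x) = E k (\<lambda>x.
      \<alpha> * (\<Sum>y\<in>T (Suc k). K (Suc k) x y * g (x(Suc k := y)))
      + \<beta> * (\<Sum>y\<in>T (Suc k). K (Suc k) x y * h (x(Suc k := y))))"
    by (simp add: sum_distrib_left sum.distrib algebra_simps)
  then show ?case by (simp add: Suc)
qed simp

lemma E_sum: "finite I \<Longrightarrow> E k (\<lambda>x. \<Sum>i\<in>I. g i x) = (\<Sum>i\<in>I. E k (g i))"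
proof (induction I rule: finite_induct)
  case empty
  show ?case using E_linear[of k 0 "\<lambda>_. 0" 0 "\<lambda>_. 0"] by simp
next
  case (insert i I)
  then show ?case using E_linear[of k 1 "g i" 1 "\<lambda>x. \<Sum>i\<in>I. g i x"] by simp
qed

lemma E_cmult: "E k (\<lambda>x. g x * \<alpha>) = E k g * \<alpha>"
  using E_linear[of k \<alpha> g 0 g] by (simp add: mult.commute)

lemma E_indep:
  assumes "k \<le> n" and g: "\<And>x y i. k < i \<Longrightarrow> g (x(i := y)) = g x"
  shows "E n g = E k g"
  using assms(1)
proof (induction n rule: dec_induct)
  case (step n)
  then have "g (x(Suc n := y)) = g x" for x y by (intro g) simp
  then show ?case using step by (simp add: K_sum flip: sum_distrib_right)
qed simp

text \<open>The method of conditional expectations: averaging out the last coordinate yields a good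
  prefix by induction, and some last value is then no worse than the average.\<close>

lemma E_witness: "E k g < t \<Longrightarrow> \<exists>x\<in>PiE {1..k} T. g x < t"
proof (induction k arbitrary: g)
  case (Suc k)
  let ?h = "\<lambda>x. \<Sum>y\<in>T (Suc k). K (Suc k) x y * g (x(Suc k := y))"
  from Suc obtain x where x: "x \<in> PiE {1..k} T" "?h x < t" by auto
  have "\<exists>y\<in>T (Suc k). g (x(Suc k := y)) < t"
  proof (rule ccontr)
    assume "\<not> ?thesis"
    then have "(\<Sum>y\<in>T (Suc k). K (Suc k) x y * t) \<le> ?h x"
      by (intro sum_mono mult_left_mono K_nonneg) auto
    then show False using x(2) by (simp add: K_sum flip: sum_distrib_right)
  qed
  then obtain y where "y \<in> T (Suc k)" "g (x(Suc k := y)) < t" by auto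
  moreover have "x(Suc k := y) \<in> PiE {1..Suc k} T"
    using x(1) \<open>y \<in> T (Suc k)\<close> by (auto simp: PiE_def Pi_def extensional_def)
  ultimately show ?case by blast
qed auto

text \<open>Averaging over the last coordinate, convexity moves all the mass that a family puts on that
  coordinate to a single value, which doubles the number of families over the other coordinates.\<close>

lemma E_matches_le:
  assumes f: "convex_incr f" and w: "\<And>k. w k \<le> 1"
  shows "E k (\<lambda>x. f (\<Sum>b\<leftarrow>bs. matches k b x)) \<le> doubling_mean w k f (length bs)"
proof (induction k arbitrary: bs)
  case 0
  have "matches 0 b x = 1" for b x
  proof -
    have "{G. G \<subseteq> {1..(0::nat)} \<and> (\<forall>i\<in>G. x i = b G i)} = {{}}" by auto
    then show ?thesis by (simp add: matches_def)
  qed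
  then show ?case by (simp add: sum_list_triv)
next
  case (Suc k)
  let ?N = "\<lambda>x. \<Sum>b\<leftarrow>bs. matches k b x"
  let ?cs = "map (lift_family (Suc k)) bs"
  let ?m = "\<lambda>x y. \<Sum>b\<leftarrow>bs. lift_matches k b x y"
  let ?M = "\<lambda>x. \<Sum>b\<leftarrow>?cs. matches k b x"
  have w0: "0 \<le> w (Suc k)"
  proof -
    have "T (Suc k) \<noteq> {}" using K_sum[of "Suc k" undefined] by auto
    then show ?thesis using K_nonneg K_le by (meson ex_in_conv order_trans)
  qed
  have "E (Suc k) (\<lambda>x. f (\<Sum>b\<leftarrow>bs. matches (Suc k) b x))
      = E k (\<lambda>x. \<Sum>y\<in>T (Suc k). K (Suc k) x y * f (?N x + ?m x y))"
    by (simp add: matches_Suc sum_list_addf)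
  also have "\<dots> \<le> E k (\<lambda>x. (1 - w (Suc k)) * f (?N x) + w (Suc k) * f (?N x + ?M x))"
  proof (intro E_mono average_convex_incr f fin K_nonneg K_le K_sum)
    fix x
    have "(\<Sum>y\<in>T (Suc k). ?m x y) \<le> (\<Sum>b\<leftarrow>bs. matches k (lift_family (Suc k) b) x)"
    proof (induction bs)
      case (Cons b bs)
      then show ?case using sum_lift_matches_le[OF fin, of k b x "Suc k"]
        by (simp add: sum.distrib)
    qed simp
    then show "(\<Sum>y\<in>T (Suc k). ?m x y) \<le> ?M x" by (simp add: comp_def)
  qed
  \<comment> \<open>Both match counts merge into one over \<open>bs @ ?cs\<close>, a list twice as
    long. This is why the induction runs over lists of families, with their length as the argument
    of \<open>doubling_mean\<close>.\<close>
  also have "\<dots> = (1 - w (Suc k)) * E k (\<lambda>x. f (?N x))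
      + w (Suc k) * E k (\<lambda>x. f (\<Sum>b\<leftarrow>bs @ ?cs. matches k b x))"
    by (simp add: E_linear)
  also have "\<dots> \<le> (1 - w (Suc k)) * doubling_mean w k f (length bs)
      + w (Suc k) * doubling_mean w k f (length (bs @ ?cs))"
    using w[of "Suc k"] w0 by (intro add_mono mult_left_mono Suc) auto
  finally show ?case by (simp add: mult_2)
qed

end

text \<open>\<open>a (insert k G)\<close> stands for a point of the hyperplane with these fixed
  coordinates, the largest being \<open>k\<close>. The sum in \<open>cost\<close> bounds the
  expected number of \<open>k\<close> at which some such hyperplane is completed, so a sampled point
  completes none.\<close>

lemma avoid_families:
  fixes T :: "nat \<Rightarrow> nat set" and c :: "nat \<Rightarrow> nat" and a :: "nat set \<Rightarrow> nat \<Rightarrow> nat"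
  defines "w \<equiv> \<lambda>k. 1 / real (card (T k) - c k)"
  assumes fin: "\<And>k. finite (T k)" and c: "\<And>k. c k < card (T k)"
    and cost: "(\<Sum>k=1..n. doubling_mean w (k - 1) (\<lambda>u. max 0 (real u - real (c k + 1))) 1 * w k) < 1"
  shows "\<exists>x\<in>PiE {1..n} T. \<forall>k G. G \<subseteq> {1..<k} \<and> G \<noteq> {} \<and> k \<le> n \<longrightarrow>
    (\<exists>i\<in>insert k G. x i \<noteq> a (insert k G) i)"
proof -
  define bad where "bad k x y \<longleftrightarrow> (\<exists>G\<subseteq>{1..<k}. G \<noteq> {} \<and>
    (\<forall>i\<in>G. x i = a (insert k G) i) \<and> y = a (insert k G) k)" for k x y
  define K where "K k x = spread {y \<in> T k. bad k x y} (T k) (c k)" for k x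
  interpret sampling T K w
    by standard (auto simp: K_def w_def fin c intro!: spread_nonneg spread_le spread_sum)
  have w1: "w k \<le> 1" for k using c[of k] by (simp add: w_def)
  let ?ind = "\<lambda>k x. of_bool (bad k x (x k)) :: real"
  let ?f = "\<lambda>k u. max 0 (real u - real (c k + 1))"
  have bad_upd: "bad k (x(i := y)) z \<longleftrightarrow> bad k x z" if "k \<le> i" for k x i y z
    using that unfolding bad_def by (intro ex_cong conj_cong ball_cong refl) auto
  \<comment> \<open>The \<open>+ 1\<close> accounts for the empty set, which always matches but is
    excluded from \<open>bad\<close>; hence the threshold \<open>c k + 1\<close> in
    \<open>?f\<close>.\<close>
  have card_bad: "card {y \<in> T (Suc k). bad (Suc k) x y} + 1
      \<le> matches k (lift_family (Suc k) a) x" for k x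
  proof -
    let ?M = "{G. G \<subseteq> {1..k} \<and> (\<forall>i\<in>G. x i = lift_family (Suc k) a G i)}"
    have finM: "finite ?M" by (rule finite_subset[of _ "Pow {1..k}"]) auto
    have "{y \<in> T (Suc k). bad (Suc k) x y} \<subseteq> (\<lambda>G. a (insert (Suc k) G) (Suc k)) ` (?M - {{}})"
      by (auto simp: bad_def lift_family_def image_iff atLeastLessThanSuc_atLeastAtMost)
    then have "card {y \<in> T (Suc k). bad (Suc k) x y} \<le> card (?M - {{}})"
      using finM by (meson card_image_le card_mono finite_Diff finite_imageI order_trans)
    moreover have "card (?M - {{}}) + 1 = card ?M"
      using card.remove[OF finM, of "{}"] by simp
    ultimately show ?thesis by (simp add: matches_def)
  qed
  have "E n (?ind (Suc k)) \<le> doubling_mean w k (?f (Suc k)) 1 * w (Suc k)" if "k < n" for k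
  proof -
    let ?X = "\<lambda>x. {y \<in> T (Suc k). bad (Suc k) x y}"
    have "E n (?ind (Suc k)) = E (Suc k) (?ind (Suc k))"
      using that by (intro E_indep) (auto simp: bad_upd)
    also have "\<dots> = E k (\<lambda>x. \<Sum>y\<in>T (Suc k). K (Suc k) x y * of_bool (bad (Suc k) x y))"
      by (simp add: bad_upd)
    also have "\<dots> = E k (\<lambda>x. \<Sum>y\<in>?X x. K (Suc k) x y)"
      by (intro arg_cong[of _ _ "E k"] ext sum.mono_neutral_cong_right fin) auto
    also have "\<dots> = E k (\<lambda>x. max 0 (real (card (?X x)) - real (c (Suc k))) * w (Suc k))"
      unfolding K_def by (subst spread_blocked) (auto simp: fin c w_def)
    also have "\<dots> \<le> E k (\<lambda>x. ?f (Suc k) (\<Sum>b\<leftarrow>[lift_family (Suc k) a]. matches k b x) * w (Suc k))"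
    proof (rule E_mono)
      fix x
      have "real (card (?X x)) + 1 \<le> real (matches k (lift_family (Suc k) a) x)"
        using card_bad[of k x] by linarith
      then show "max 0 (real (card (?X x)) - real (c (Suc k))) * w (Suc k)
          \<le> ?f (Suc k) (\<Sum>b\<leftarrow>[lift_family (Suc k) a]. matches k b x) * w (Suc k)"
        by (intro mult_right_mono) (auto simp: w_def)
    qed
    also have "\<dots> = E k (\<lambda>x. ?f (Suc k) (\<Sum>b\<leftarrow>[lift_family (Suc k) a]. matches k b x)) * w (Suc k)"
      by (rule E_cmult)
    also have "\<dots> \<le> doubling_mean w k (?f (Suc k)) (length [lift_family (Suc k) a]) * w (Suc k)"
      by (intro mult_right_mono E_matches_le convex_incr_max w1) (simp add: w_def)
    finally show ?thesis by simp
  qed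
  then have ind_le: "E n (?ind k) \<le> doubling_mean w (k - 1) (?f k) 1 * w k" if "k \<in> {1..n}" for k
    using that by (cases k) auto
  have "E n (\<lambda>x. \<Sum>k=1..n. ?ind k x) = (\<Sum>k=1..n. E n (?ind k))"
    by (rule E_sum) simp
  also have "\<dots> \<le> (\<Sum>k=1..n. doubling_mean w (k - 1) (?f k) 1 * w k)"
    by (intro sum_mono ind_le)
  also have "\<dots> < 1"
    by (rule cost)
  finally obtain x where x: "x \<in> PiE {1..n} T" "(\<Sum>k=1..n. ?ind k x) < 1"
    using E_witness by blast
  have not_bad: "\<not> bad k x (x k)" if "k \<in> {1..n}" for k
  proof
    assume "bad k x (x k)"
    then have "1 \<le> (\<Sum>k=1..n. ?ind k x)"
      using member_le_sum[of k "{1..n}" "\<lambda>k. ?ind k x"] that by simp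
    with x(2) show False by simp
  qed
  show ?thesis
  proof (intro bexI[OF _ x(1)] allI impI, elim conjE)
    fix k G assume G: "G \<subseteq> {1..<k}" "G \<noteq> {}" "k \<le> n"
    then have "k \<in> {1..n}" by (cases k) auto
    from not_bad[OF this] G show "\<exists>i\<in>insert k G. x i \<noteq> a (insert k G) i"
      unfolding bad_def by auto
  qed
qed

section \<open>Numerical bounds for the worst case\<close>

text \<open>Comparing only at the attained values \<open>t * 2 ^ i\<close> is what allows
  \<open>excess_eq\<close> to replace a function by one that differs elsewhere.\<close>

lemma doubling_mean_mono:
  assumes w: "\<And>k. 0 \<le> w k" "\<And>k. w k \<le> 1" and le: "\<And>i. f (t * 2 ^ i) \<le> g (t * 2 ^ i)"
  shows "doubling_mean w k f t \<le> doubling_mean w k g t"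
  using le
proof (induction k arbitrary: t)
  case 0
  from 0[of 0] show ?case by simp
next
  case (Suc k)
  have "doubling_mean w k f t \<le> doubling_mean w k g t"
    by (intro Suc.IH Suc.prems)
  moreover have "doubling_mean w k f (2 * t) \<le> doubling_mean w k g (2 * t)"
  proof (rule Suc.IH)
    fix i show "f (2 * t * 2 ^ i) \<le> g (2 * t * 2 ^ i)"
      using Suc.prems[of "Suc i"] by (simp add: mult_ac)
  qed
  ultimately show ?case using w[of "Suc k"] by (auto intro!: add_mono mult_left_mono)
qed

lemma doubling_mean_cmult:
  "doubling_mean w k (\<lambda>u. f u * \<alpha>) t = doubling_mean w k f t * \<alpha>"
  by (induction k arbitrary: t) (simp_all add: algebra_simps)

lemma doubling_mean_add:
  "doubling_mean w k (\<lambda>u. f u + g u) t = doubling_mean w k f t + doubling_mean w k g t"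
  by (induction k arbitrary: t) (simp_all add: algebra_simps)

lemma doubling_mean_const: "doubling_mean w k (\<lambda>_. \<alpha>) t = \<alpha>"
  by (induction k arbitrary: t) (simp_all add: algebra_simps)

lemma doubling_mean_sum:
  "finite J \<Longrightarrow> doubling_mean w k (\<lambda>u. \<Sum>j\<in>J. f j u) t = (\<Sum>j\<in>J. doubling_mean w k (f j) t)"
  by (induction J rule: finite_induct) (simp_all add: doubling_mean_add doubling_mean_const)

lemma doubling_mean_double:
  "doubling_mean w k f (2 * t) = doubling_mean w k (\<lambda>u. f (2 * u)) t"
proof (induction k arbitrary: t)
  case (Suc k)
  show ?case by (simp only: doubling_mean.simps Suc.IH)
qed simp

lemma doubling_mean_id:
  "doubling_mean w k real t = real t * (\<Prod>i=1..k. 1 + w i)"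
  by (induction k arbitrary: t) (simp_all add: algebra_simps)

text \<open>A Bernoulli factor contributes \<open>(1 - w i) + 4 * w i\<close> to the mean of
  \<open>4 ^ J\<close>.\<close>

lemma doubling_mean_square:
  "doubling_mean w k (\<lambda>u. (real u)\<^sup>2) t = (real t)\<^sup>2 * (\<Prod>i=1..k. 1 + 3 * w i)"
  by (induction k arbitrary: t) (simp_all add: algebra_simps)

definition weight_at :: "(nat \<Rightarrow> real) \<Rightarrow> nat \<Rightarrow> nat \<Rightarrow> real" where
  "weight_at w k j = doubling_mean w k (\<lambda>u. of_bool (u = 2 ^ j)) 1"

lemma weight_at_0: "weight_at w 0 j = of_bool (j = 0)"
  by (auto simp: weight_at_def eq_commute[of "Suc 0"])

lemma weight_at_Suc:
  "weight_at w (Suc k) j = (1 - w (Suc k)) * weight_at w k j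
    + w (Suc k) * (if j = 0 then 0 else weight_at w k (j - 1))"
proof -
  have "doubling_mean w k (\<lambda>u. of_bool (2 * u = (2::nat) ^ j)) 1
      = (if j = 0 then 0 else weight_at w k (j - 1))"
  proof (cases j)
    case 0
    have "2 * u \<noteq> Suc 0" for u :: nat by presburger
    then show ?thesis using 0 by (simp add: doubling_mean_const)
  qed (simp add: weight_at_def)
  then show ?thesis
    using doubling_mean_double[of w k "\<lambda>u. of_bool (u = 2 ^ j)" 1] by (simp add: weight_at_def)
qed

definition excess :: "(nat \<Rightarrow> real) \<Rightarrow> nat \<Rightarrow> nat \<Rightarrow> real" where
  "excess w k s = doubling_mean w k (\<lambda>u. max 0 (real u - real s)) 1"

lemma excess_nonneg:
  assumes "\<And>k. 0 \<le> w k" "\<And>k. w k \<le> 1"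
  shows "0 \<le> excess w k s"
  using doubling_mean_mono[where f = "\<lambda>_. 0" and g = "\<lambda>u. max 0 (real u - real s)", OF assms]
  by (simp add: excess_def doubling_mean_const)

text \<open>The parabola \<open>u\<^sup>2 / (4 * s)\<close> lies above \<open>max 0 (u - s)\<close>
  and touches it at \<open>u = 2 * s\<close>; its mean is the second moment.\<close>

lemma excess_le_square:
  assumes w: "\<And>k. 0 \<le> w k" "\<And>k. w k \<le> 1" and s: "0 < s"
  shows "excess w k s \<le> (\<Prod>i=1..k. 1 + 3 * w i) / (4 * real s)"
proof -
  have "max 0 (real u - real s) \<le> (real u)\<^sup>2 * (1 / (4 * real s))" for u
  proof -
    have "0 \<le> (real u - 2 * real s)\<^sup>2" by simp
    then have "4 * real s * (real u - real s) \<le> (real u)\<^sup>2"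
      by (simp add: power2_eq_square algebra_simps)
    then show ?thesis using s by (simp add: field_simps)
  qed
  then have "excess w k s \<le> doubling_mean w k (\<lambda>u. (real u)\<^sup>2 * (1 / (4 * real s))) 1"
    unfolding excess_def by (intro doubling_mean_mono w)
  then show ?thesis by (simp only: doubling_mean_cmult doubling_mean_square) simp
qed

text \<open>Write \<open>max 0 (u - s)\<close> as \<open>u - s + max 0 (s - u)\<close>; the last
  term vanishes at \<open>2 ^ j\<close> for \<open>j \<ge> J\<close>. The mean and the first
  \<open>J\<close> weights enter with nonnegative coefficients, so upper bounds for them bound the
  excess.\<close>

lemma excess_eq:
  assumes w: "\<And>k. 0 \<le> w k" "\<And>k. w k \<le> 1" and s: "s \<le> 2 ^ J"
  shows "excess w k s = (\<Prod>i=1..k. 1 + w i) - real s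
    + (\<Sum>j<J. weight_at w k j * max 0 (real s - 2 ^ j))"
proof -
  let ?g = "\<lambda>u. real u + (- real s + (\<Sum>j<J. of_bool (u = 2 ^ j) * max 0 (real s - 2 ^ j)))"
  have "max 0 (real (2 ^ i) - real s) = ?g (2 ^ i)" for i
  proof (cases "i < J")
    case True
    have "(\<Sum>j<J. of_bool ((2::nat) ^ i = 2 ^ j) * max 0 (real s - 2 ^ j))
        = (\<Sum>j<J. if j = i then max 0 (real s - 2 ^ i) else 0)"
      by (intro sum.cong) auto
    also have "\<dots> = max 0 (real s - 2 ^ i)" using True by simp
    finally show ?thesis by simp
  next
    case False
    then have "(\<Sum>j<J. of_bool ((2::nat) ^ i = 2 ^ j) * max 0 (real s - 2 ^ j)) = 0"
      by (intro sum.neutral) auto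
    moreover have "(2::nat) ^ J \<le> 2 ^ i" using False by simp
    then have "real s \<le> real (2 ^ i)" using s by (simp only: of_nat_le_iff)
    ultimately show ?thesis by simp
  qed
  then have "excess w k s = doubling_mean w k ?g 1"
    unfolding excess_def by (intro antisym doubling_mean_mono w) auto
  also have "\<dots> = (\<Prod>i=1..k. 1 + w i) + (- real s
      + (\<Sum>j<J. weight_at w k j * max 0 (real s - 2 ^ j)))"
    unfolding doubling_mean_add doubling_mean_const doubling_mean_sum[OF finite_lessThan]
      doubling_mean_cmult doubling_mean_id weight_at_def by simp
  finally show ?thesis by simp
qed

section \<open>Rigorous fixed-point evaluation\<close>

type_synonym fixpoint = "int list \<times> int \<times> int \<times> int"

text \<open>A state holds upper bounds, scaled by \<open>10 ^ 9\<close> and rounded up, for the probabilities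
  of \<open>J = 0, \<dots>, 9\<close>, the first two moments of \<open>2 ^ J\<close> and the accumulated cost. Larger values of
  \<open>J\<close> do not matter: \<open>max 0 (2 ^ J - s)\<close> differs from \<open>2 ^ J - s\<close> only for \<open>2 ^ J < s\<close>,
  and \<open>s \<le> 1024\<close> for primes below \<open>4096\<close>.\<close>

definition advance :: "int \<Rightarrow> fixpoint \<Rightarrow> fixpoint" where
  "advance q = (\<lambda>(p, m1, m2, s). let c = (q - 1) div 4; d = q - 1 - c in
     (map2 (\<lambda>x y. ((d - 1) * x + y) div d + 1) p (0 # p),
      ((d + 1) * m1) div d + 1, ((d + 3) * m2) div d + 1,
      s + (m1 - 10^9 * (c + 1) + sum_list (map2 (\<lambda>x e. x * max 0 (c + 1 - e)) p [1,2,4,8,16,32,64,128,256,512])) div d + 1))"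

definition approx :: "(nat \<Rightarrow> real) \<Rightarrow> (nat \<Rightarrow> real) \<Rightarrow> nat \<Rightarrow> fixpoint \<Rightarrow> bool" where
  "approx w C k = (\<lambda>(p :: int list, m1 :: int, m2 :: int, s :: int). length p = 10 \<and>
     (\<forall>j<10. 10 ^ 9 * weight_at w k j \<le> real_of_int (p ! j)) \<and>
     10 ^ 9 * (\<Prod>i=1..k. 1 + w i) \<le> real_of_int m1 \<and>
     10 ^ 9 * (\<Prod>i=1..k. 1 + 3 * w i) \<le> real_of_int m2 \<and>
     10 ^ 9 * (\<Sum>i=1..k. C i) \<le> real_of_int s)"

lemma le_div_add_one:
  fixes a d :: int and x :: real
  assumes "x * d \<le> a" "0 < d"
  shows "x \<le> a div d + 1"
proof -
  have "a \<le> (a div d + 1) * d"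
    using assms(2) by (simp add: distrib_right flip: minus_mod_eq_div_mult)
      (smt (verit) pos_mod_bound)
  then have "real_of_int a \<le> real_of_int (a div d + 1) * real_of_int d"
    by (metis of_int_le_iff of_int_mult)
  then have "x * real_of_int d \<le> real_of_int (a div d + 1) * real_of_int d"
    using assms(1) by linarith
  then have "x \<le> real_of_int (a div d + 1)" using assms(2) by simp
  then show ?thesis by simp
qed

text \<open>Multiplied by \<open>d\<close>, where \<open>w (Suc k) = 1 / d\<close>, the recurrences
  have nonnegative integer coefficients on the bounded quantities, so upper bounds propagate and
  \<open>le_div_add_one\<close> does the rounding. The cost increment uses the weights and mean
  before the update, as \<open>excess w k\<close> concerns the first \<open>k\<close>
  coordinates.\<close>

lemma approx_advance:
  assumes st: "approx w C k st"
    and w: "\<And>k. 0 \<le> w k" "\<And>k. w k \<le> 1"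
    and q: "1 < q" "q \<le> 4096"
    and wk: "w (Suc k) = 1 / real_of_int (q - 1 - (q - 1) div 4)"
    and Ck: "C (Suc k) = excess w k (nat ((q - 1) div 4 + 1)) * w (Suc k)"
  shows "approx w C (Suc k) (advance q st)"
proof -
  obtain p m1 m2 s where st_eq: "st = (p, m1, m2, s)" by (cases st)
  define c where "c = (q - 1) div 4"
  define d where "d = q - 1 - c"
  define S where "S = sum_list (map2 (\<lambda>x e. x * max 0 (c + 1 - e)) p [1,2,4,8,16,32,64,128,256,512])"
  have len: "length p = 10" and p: "\<And>j. j < 10 \<Longrightarrow> 10 ^ 9 * weight_at w k j \<le> p ! j"
    and m1: "10 ^ 9 * (\<Prod>i=1..k. 1 + w i) \<le> m1"
    and m2: "10 ^ 9 * (\<Prod>i=1..k. 1 + 3 * w i) \<le> m2"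
    and s: "10 ^ 9 * (\<Sum>i=1..k. C i) \<le> s"
    using st by (auto simp: approx_def st_eq)
  have c0: "0 \<le> c" and c1: "c + 1 \<le> 1024" and d0: "0 < d"
    using q by (auto simp: c_def d_def)
  have wd: "w (Suc k) = 1 / real_of_int d" using wk by (simp add: d_def c_def)
  have dr: "1 \<le> real_of_int d" using d0 by simp
  have p': "10 ^ 9 * weight_at w (Suc k) j \<le> ((d - 1) * p ! j + (0 # p) ! j) div d + 1"
    if j: "j < 10" for j
  proof (rule le_div_add_one[OF _ d0])
    have prev: "10 ^ 9 * (if j = 0 then 0 else weight_at w k (j - 1)) \<le> real_of_int ((0 # p) ! j)"
      using p[of "j - 1"] j by (cases j) auto
    have "10 ^ 9 * weight_at w (Suc k) j * d = (real_of_int d - 1) * (10 ^ 9 * weight_at w k j)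
        + 10 ^ 9 * (if j = 0 then 0 else weight_at w k (j - 1))"
      using dr by (simp add: weight_at_Suc wd field_simps)
    also have "\<dots> \<le> (real_of_int d - 1) * real_of_int (p ! j) + real_of_int ((0 # p) ! j)"
      using p[OF j] dr by (intro add_mono mult_left_mono prev) auto
    finally show "10 ^ 9 * weight_at w (Suc k) j * d \<le> real_of_int ((d - 1) * p ! j + (0 # p) ! j)"
      by simp
  qed
  have m1': "10 ^ 9 * (\<Prod>i=1..Suc k. 1 + w i) \<le> ((d + 1) * m1) div d + 1"
  proof (rule le_div_add_one[OF _ d0])
    have "10 ^ 9 * (\<Prod>i=1..Suc k. 1 + w i) * d = (real_of_int d + 1) * (10 ^ 9 * (\<Prod>i=1..k. 1 + w i))"
      using dr by (simp add: wd field_simps)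
    also have "\<dots> \<le> (real_of_int d + 1) * m1" using dr by (intro mult_left_mono m1) auto
    finally show "10 ^ 9 * (\<Prod>i=1..Suc k. 1 + w i) * d \<le> real_of_int ((d + 1) * m1)" by simp
  qed
  have m2': "10 ^ 9 * (\<Prod>i=1..Suc k. 1 + 3 * w i) \<le> ((d + 3) * m2) div d + 1"
  proof (rule le_div_add_one[OF _ d0])
    have "10 ^ 9 * (\<Prod>i=1..Suc k. 1 + 3 * w i) * d
        = (real_of_int d + 3) * (10 ^ 9 * (\<Prod>i=1..k. 1 + 3 * w i))"
      using dr by (simp add: wd field_simps)
    also have "\<dots> \<le> (real_of_int d + 3) * m2" using dr by (intro mult_left_mono m2) auto
    finally show "10 ^ 9 * (\<Prod>i=1..Suc k. 1 + 3 * w i) * d \<le> real_of_int ((d + 3) * m2)" by simp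
  qed
  have S_eq: "S = (\<Sum>j<10. p ! j * max 0 (c + 1 - 2 ^ j))"
  proof -
    have pw: "[1,2,4,8,16,32,64,128,256,512] = map (\<lambda>j. (2::int) ^ j) [0..<10]"
      by (simp add: upt_rec)
    show ?thesis
      unfolding S_def pw by (simp add: sum_list_sum_nth len atLeast0LessThan)
  qed
  have s_nat: "real (nat (c + 1)) = real_of_int c + 1" using c0 by simp
  have "excess w k (nat (c + 1)) = (\<Prod>i=1..k. 1 + w i) - real (nat (c + 1))
    + (\<Sum>j<10. weight_at w k j * max 0 (real (nat (c + 1)) - 2 ^ j))"
    by (rule excess_eq[OF w]) (use c0 c1 in simp)
  then have "10 ^ 9 * excess w k (nat (c + 1)) = 10 ^ 9 * (\<Prod>i=1..k. 1 + w i) - 10 ^ 9 * (real_of_int c + 1)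
    + (\<Sum>j<10. 10 ^ 9 * weight_at w k j * max 0 (real_of_int c + 1 - 2 ^ j))"
    unfolding s_nat by (simp only: distrib_left right_diff_distrib sum_distrib_left mult.assoc)
  also have "\<dots> \<le> m1 - 10 ^ 9 * (real_of_int c + 1)
    + (\<Sum>j<10. real_of_int (p ! j) * max 0 (real_of_int c + 1 - 2 ^ j))"
    using m1 c0 by (intro add_mono diff_mono sum_mono mult_right_mono p) auto
  also have "\<dots> = real_of_int (m1 - 10 ^ 9 * (c + 1) + S)"
    by (simp add: S_eq of_int_max)
  finally have exc: "10 ^ 9 * excess w k (nat (c + 1)) \<le> real_of_int (m1 - 10 ^ 9 * (c + 1) + S)" .
  have "10 ^ 9 * C (Suc k) \<le> (m1 - 10 ^ 9 * (c + 1) + S) div d + 1"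
  proof (rule le_div_add_one[OF _ d0])
    have "10 ^ 9 * C (Suc k) * d = 10 ^ 9 * excess w k (nat (c + 1))"
      using dr by (simp add: Ck wd c_def)
    with exc show "10 ^ 9 * C (Suc k) * d \<le> real_of_int (m1 - 10 ^ 9 * (c + 1) + S)" by simp
  qed
  with s have s': "10 ^ 9 * (\<Sum>i=1..Suc k. C i) \<le> s + (m1 - 10 ^ 9 * (c + 1) + S) div d + 1"
    by (simp add: distrib_left)
  have adv: "advance q st = (map2 (\<lambda>x y. ((d - 1) * x + y) div d + 1) p (0 # p),
      ((d + 1) * m1) div d + 1, ((d + 3) * m2) div d + 1,
      s + (m1 - 10 ^ 9 * (c + 1) + S) div d + 1)"
    by (simp add: advance_def st_eq Let_def c_def d_def S_def)
  show ?thesis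
    unfolding adv approx_def using p' m1' m2' s' len by simp
qed

section \<open>Large primes\<close>

text \<open>Chebyshev's argument: with \<open>N = 2 ^ m\<close>, the primes in
  \<open>(N, 2 * N]\<close> all divide the central binomial coefficient, which is at most
  \<open>4 ^ N\<close>, while their product is at least \<open>N ^ card P\<close>.\<close>

lemma card_primes_dyadic:
  "card {p. prime p \<and> 2 ^ m < p \<and> p \<le> (2::nat) ^ Suc m} * m \<le> 2 ^ Suc m"
proof -
  define N :: nat where "N = 2 ^ m"
  define P where "P = {p. prime p \<and> N < p \<and> p \<le> 2 * N}"
  have fin: "finite P" by (rule finite_subset[of _ "{..2 * N}"]) (auto simp: P_def)
  have dvd: "p dvd (2 * N choose N)" if "p \<in> P" for p
  proof -
    have p: "prime p" "N < p" "p \<le> 2 * N" using that by (auto simp: P_def)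
    have "fact N * fact N * (2 * N choose N) = (fact (2 * N) :: nat)"
      using binomial_fact_lemma[of N "2 * N"] by simp
    then have "p dvd fact N * fact N * (2 * N choose N)"
      using p by (simp add: prime_dvd_fact_iff)
    then show ?thesis using p by (simp add: prime_dvd_mult_iff prime_dvd_fact_iff)
  qed
  have "\<forall>p\<in>P. prime p \<and> p dvd (2 * N choose N)"
    using dvd by (auto simp: P_def)
  with fin have "\<Prod>P dvd (2 * N choose N)"
  proof (induction P rule: finite_induct)
    case (insert p P)
    then have "coprime p (\<Prod>P)"
      by (intro prod_coprime_right primes_coprime) auto
    then show ?case using insert by (simp add: divides_mult)
  qed simp
  then have "\<Prod>P \<le> (2 * N choose N)"
    by (rule dvd_imp_le) simp
  moreover have "N ^ card P \<le> \<Prod>P"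
    using prod_mono[of P "\<lambda>_. N" "\<lambda>p. p"] by (auto simp: P_def less_imp_le)
  moreover have "(2 * N choose N) \<le> 2 ^ (2 * N)"
    using member_le_sum[of N "{..2 * N}" "\<lambda>k. 2 * N choose k"] by (simp add: choose_row_sum)
  ultimately have "(2::nat) ^ (m * card P) \<le> 2 ^ (2 * N)"
    unfolding N_def by (simp add: power_mult)
  then have "m * card P \<le> 2 * N" by simp
  then show ?thesis by (simp add: P_def N_def mult.commute)
qed

text \<open>The difference \<open>?h\<close> has derivative \<open>1 - (1 - y) * exp y\<close>,
  nonnegative because \<open>1 - y \<le> exp (- y)\<close>.\<close>

lemma exp_le_Pade:
  fixes x :: real
  assumes "0 \<le> x" "x < 2"
  shows "exp x \<le> (2 + x) / (2 - x)"
proof -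
  let ?h = "\<lambda>x::real. (2 + x) - (2 - x) * exp x"
  have "?h 0 \<le> ?h x"
  proof (rule DERIV_nonneg_imp_nondecreasing[OF assms(1)])
    fix y :: real
    have "(1 - y) * exp y \<le> exp (- y) * exp y"
      using exp_ge_add_one_self[of "- y"] by (intro mult_right_mono) auto
    then have "0 \<le> 1 - (1 - y) * exp y" by (simp flip: exp_add)
    moreover have "(?h has_real_derivative 1 - (1 - y) * exp y) (at y)"
      by (auto intro!: derivative_eq_intros simp: algebra_simps)
    ultimately show "\<exists>z. (?h has_real_derivative z) (at y) \<and> 0 \<le> z" by blast
  qed
  then show ?thesis using assms by (simp add: field_simps)
qed

text \<open>The potential \<open>\<Sum>C + c m * M / 3\<close> does not increase over a dyadic block of primes, in which
  \<open>M\<close> grows by a factor of at most \<open>exp (8 / m) \<le> (m + 4) / (m - 4)\<close>. This amounts to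
  \<open>(m + 4) * (2 * m + 7) * (m - 8) \<le> 2 * (m - 4) * (m + 13) * (m - 7)\<close>, whose two sides differ
  by \<open>(5 * m - 68) * (m - 14)\<close>; the constants in \<open>c m\<close> were chosen to make this true for
  all integers \<open>m \<ge> 12\<close>.\<close>

lemma tail_bound:
  fixes q :: "nat \<Rightarrow> nat" and M C :: "nat \<Rightarrow> real"
  assumes q: "strict_mono q" "\<And>k. prime (q k)"
    and large: "\<And>k. K < k \<Longrightarrow> 4096 < q k"
    and M: "0 \<le> M K" "\<And>k. K \<le> k \<Longrightarrow> M k \<le> M (Suc k)"
    and grow: "\<And>k. K < k \<Longrightarrow> M k \<le> M (k - 1) * (1 + 4 / (real (q k) - 1))"
    and cost: "\<And>k. K < k \<Longrightarrow> C k \<le> (M k - M (k - 1)) / (3 * (real (q k) - 1))"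
    and n: "K \<le> n"
  shows "(\<Sum>k\<in>{K<..n}. C k) \<le> 21 / 12 * M K / 4096"
proof -
  define c where "c m = 21 / ((real m - 8) * 2 ^ m)" for m :: nat
  have M_mono: "M a \<le> M b" if "K \<le> a" "a \<le> b" for a b
    using that(2,1) M(2) by (induction b rule: dec_induct) (auto intro: order_trans)
  have M0: "0 \<le> M a" if "K \<le> a" for a
    using M(1) M_mono[OF order_refl that] by simp
  have block_M: "M b \<le> M a * exp (real (b - a) * (4 / 2 ^ m))"
    if "K \<le> a" "a \<le> b" "\<And>k. a < k \<Longrightarrow> k \<le> b \<Longrightarrow> 2 ^ m < q k" for a b m
    using that(2,1,3)
  proof (induction b rule: dec_induct)
    case (step b)
    have "(2::nat) ^ m + 1 \<le> q (Suc b)" using step.prems(2)[of "Suc b"] step.hyps by simp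
    then have "real (2 ^ m + 1) \<le> real (q (Suc b))" by (simp only: of_nat_le_iff)
    then have qb: "2 ^ m \<le> real (q (Suc b)) - 1" by simp
    have "M (Suc b) \<le> M b * (1 + 4 / (real (q (Suc b)) - 1))"
      using grow[of "Suc b"] step by simp
    also have "\<dots> \<le> M b * exp (4 / 2 ^ m)"
    proof (rule mult_left_mono)
      have "4 / (real (q (Suc b)) - 1) \<le> 4 / 2 ^ m"
        using qb by (intro divide_left_mono mult_pos_pos less_le_trans[OF _ qb]) auto
      then show "1 + 4 / (real (q (Suc b)) - 1) \<le> exp (4 / 2 ^ m)"
        using exp_ge_add_one_self[of "4 / 2 ^ m :: real"] by linarith
    qed (use M0[of b] step in simp)
    also have "\<dots> \<le> M a * exp (real (b - a) * (4 / 2 ^ m)) * exp (4 / 2 ^ m)"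
      using step by (intro mult_right_mono step.IH) auto
    also have "\<dots> = M a * exp (real (b - a) * (4 / 2 ^ m) + 4 / 2 ^ m)"
      by (simp only: exp_add mult.assoc)
    also have "real (b - a) * (4 / 2 ^ m) + 4 / 2 ^ m = real (Suc b - a) * (4 / 2 ^ m)"
      using step.hyps by (simp add: Suc_diff_le field_simps)
    finally show ?case .
  qed simp
  have block_C: "(\<Sum>k\<in>{a<..b}. C k) \<le> (M b - M a) / (3 * 2 ^ m)"
    if "K \<le> a" "a \<le> b" "\<And>k. a < k \<Longrightarrow> k \<le> b \<Longrightarrow> 2 ^ m < q k" for a b m
    using that(2,1,3)
  proof (induction b rule: dec_induct)
    case (step b)
    have "(2::nat) ^ m + 1 \<le> q (Suc b)" using step.prems(2)[of "Suc b"] step.hyps by simp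
    then have "real (2 ^ m + 1) \<le> real (q (Suc b))" by (simp only: of_nat_le_iff)
    then have qb: "2 ^ m \<le> real (q (Suc b)) - 1" by simp
    have "C (Suc b) \<le> (M (Suc b) - M b) / (3 * (real (q (Suc b)) - 1))"
      using cost[of "Suc b"] step by simp
    also have "\<dots> \<le> (M (Suc b) - M b) / (3 * 2 ^ m)"
      using qb M(2)[of b] step by (intro divide_left_mono mult_pos_pos less_le_trans[OF _ qb]) auto
    finally have "C (Suc b) \<le> (M (Suc b) - M b) / (3 * 2 ^ m)" .
    moreover have "{a<..Suc b} = insert (Suc b) {a<..b}" using step.hyps by auto
    ultimately show ?case using step by (auto simp: diff_divide_distrib)
  qed simp
  have potential: "(\<Sum>k\<in>{K<..n}. C k) + c m * M n / 3 \<le> c 12 * M K / 3"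
    if "12 \<le> m" "K \<le> n" "\<And>k. K < k \<Longrightarrow> k \<le> n \<Longrightarrow> q k \<le> 2 ^ m" for m n
    using that
  proof (induction m arbitrary: n rule: dec_induct)
    case base
    \<comment> \<open>Beyond \<open>K\<close> every \<open>q k\<close> exceeds
      \<open>4096 = 2 ^ 12\<close>, so the first block starts from an empty range.\<close>
    have "n = K" using base(2)[of n] large[of n] base(1) by (cases "n = K") auto
    then show ?case by simp
  next
    case (step m)
    \<comment> \<open>\<open>a\<close> is the last index before the block
      \<open>(2 ^ m, 2 ^ Suc m]\<close>; admitting \<open>k = K\<close> keeps the set
      nonempty.\<close>
    let ?A = "{k \<in> {K..n}. k = K \<or> q k \<le> 2 ^ m}"
    define a where "a = Max ?A"
    have "a \<in> ?A" unfolding a_def using step.prems(1) by (intro Max_in) auto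
    then have a: "K \<le> a" "a \<le> n" "a = K \<or> q a \<le> 2 ^ m" by auto
    have above: "2 ^ m < q k" if "a < k" "k \<le> n" for k
    proof (rule ccontr)
      assume "\<not> ?thesis"
      then have "k \<in> ?A" using that a by auto
      then have "k \<le> a" unfolding a_def by (intro Max_ge) auto
      with that show False by simp
    qed
    have below: "q k \<le> 2 ^ m" if "K < k" "k \<le> a" for k
    proof -
      have "q k \<le> q a" using q(1) that by (simp add: strict_mono_less_eq)
      then show ?thesis using a(3) that by auto
    qed
    have "card {a<..n} \<le> card {p. prime p \<and> 2 ^ m < p \<and> p \<le> (2::nat) ^ Suc m}"
    proof (rule card_inj_on_le[where f = q])
      show "inj_on q {a<..n}" using strict_mono_imp_inj_on[OF q(1)] by (rule inj_on_subset) auto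
      show "q ` {a<..n} \<subseteq> {p. prime p \<and> 2 ^ m < p \<and> p \<le> (2::nat) ^ Suc m}"
        using q(2) above step.prems(2) a(1) by auto
      show "finite {p. prime p \<and> 2 ^ m < p \<and> p \<le> (2::nat) ^ Suc m}"
        by (rule finite_subset[of _ "{..2 ^ Suc m}"]) auto
    qed
    then have "(n - a) * m \<le> 2 ^ Suc m"
      using card_primes_dyadic[of m] unfolding card_greaterThanAtMost
      by (meson mult_le_mono1 order_trans)
    then have "real ((n - a) * m) \<le> real (2 ^ Suc m)" by (simp only: of_nat_le_iff)
    then have cnt: "real (n - a) * (4 / 2 ^ m) \<le> 8 / real m"
      using step.hyps by (simp add: field_simps)
    have m12: "12 \<le> real m" using step.hyps by simp
    have "M n \<le> M a * exp (real (n - a) * (4 / 2 ^ m))"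
      by (rule block_M) (use a above in auto)
    also have "\<dots> \<le> M a * exp (8 / real m)"
      using M0[OF a(1)] cnt by (intro mult_left_mono) auto
    also have "\<dots> \<le> M a * ((real m + 4) / (real m - 4))"
    proof (rule mult_left_mono)
      have "(2 + 8 / real m) / (2 - 8 / real m) = (real m + 4) / (real m - 4)"
        using m12 by (simp add: field_simps)
      moreover have "exp (8 / real m) \<le> (2 + 8 / real m) / (2 - 8 / real m)"
        using m12 by (intro exp_le_Pade) (auto simp: field_simps)
      ultimately show "exp (8 / real m) \<le> (real m + 4) / (real m - 4)" by simp
    qed (rule M0[OF a(1)])
    finally have Mn: "M n * (real m - 4) \<le> M a * (real m + 4)"
      using m12 by (simp add: field_simps)
    \<comment> \<open>The factors vanish at \<open>68 / 5\<close> and \<open>14\<close>, and no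
      integer lies strictly between.\<close>
    have "0 \<le> (5 * int m - 68) * (int m - 14)"
    proof (cases "m \<ge> 14")
      case True then show ?thesis by (intro mult_nonneg_nonneg) auto
    next
      case False then show ?thesis by (intro mult_nonpos_nonpos) auto
    qed
    then have "real_of_int 0 \<le> real_of_int ((5 * int m - 68) * (int m - 14))"
      by (simp only: of_int_le_iff)
    then have poly: "(real m + 4) * ((2 * real m + 7) * (real m - 8))
        \<le> (real m - 4) * (2 * (real m + 13) * (real m - 7))"
      by (simp add: algebra_simps power2_eq_square)
    have "M n * (real m - 4) * ((2 * real m + 7) * (real m - 8))
        \<le> M a * (real m + 4) * ((2 * real m + 7) * (real m - 8))"
      using m12 by (intro mult_right_mono[OF Mn]) auto
    also have "\<dots> = M a * ((real m + 4) * ((2 * real m + 7) * (real m - 8)))"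
      by (simp only: mult.assoc)
    also have "\<dots> \<le> M a * ((real m - 4) * (2 * (real m + 13) * (real m - 7)))"
      by (intro mult_left_mono poly M0[OF a(1)])
    finally have "(real m - 4) * (M n * ((2 * real m + 7) * (real m - 8)))
        \<le> (real m - 4) * (M a * (2 * (real m + 13) * (real m - 7)))"
      by (simp only: mult_ac)
    then have key: "M n * ((2 * real m + 7) * (real m - 8)) \<le> M a * (2 * (real m + 13) * (real m - 7))"
      using m12 by (subst (asm) mult_le_cancel_left_pos) auto
    have cm: "1 / 2 ^ m + c m = (real m + 13) / (real m - 8) / 2 ^ m"
      using m12 by (simp add: c_def field_simps)
    have cSm: "1 / 2 ^ m + c (Suc m) = (2 * real m + 7) / (2 * (real m - 7)) / 2 ^ m"
      using m12 by (simp add: c_def field_simps)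
    have "M n * ((2 * real m + 7) / (2 * (real m - 7)))
        = M n * ((2 * real m + 7) * (real m - 8)) / (2 * (real m - 7) * (real m - 8))"
      using m12 by simp
    also have "\<dots> \<le> M a * (2 * (real m + 13) * (real m - 7)) / (2 * (real m - 7) * (real m - 8))"
      using m12 by (intro divide_right_mono key) auto
    also have "\<dots> = (2 * (real m - 7) * (M a * (real m + 13))) / (2 * (real m - 7) * (real m - 8))"
      by (simp only: mult_ac)
    also have "\<dots> = M a * ((real m + 13) / (real m - 8))"
      using m12 by (subst mult_divide_mult_cancel_left) auto
    finally have "M n * ((2 * real m + 7) / (2 * (real m - 7))) / 2 ^ m
        \<le> M a * ((real m + 13) / (real m - 8)) / 2 ^ m"
      by (intro divide_right_mono) auto
    then have "M n * (1 / 2 ^ m + c (Suc m)) \<le> M a * (1 / 2 ^ m + c m)"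
      unfolding cm cSm by simp
    moreover define t where "t = 1 / (2::real) ^ m"
    ultimately have "M n * t + M n * c (Suc m) \<le> M a * t + M a * c m"
      by (simp add: distrib_left)
    then have "(M n * t - M a * t) / 3 + M n * c (Suc m) / 3 \<le> M a * c m / 3"
      by argo
    then have pot: "(M n - M a) / (3 * 2 ^ m) + c (Suc m) * M n / 3 \<le> c m * M a / 3"
      by (simp add: t_def diff_divide_distrib mult.commute)
    have "{K<..n} = {K<..a} \<union> {a<..n}" using a by auto
    then have "(\<Sum>k\<in>{K<..n}. C k) = (\<Sum>k\<in>{K<..a}. C k) + (\<Sum>k\<in>{a<..n}. C k)"
      by (simp add: sum.union_disjoint ivl_disj_int)
    also have "(\<Sum>k\<in>{a<..n}. C k) \<le> (M n - M a) / (3 * 2 ^ m)"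
      by (rule block_C) (use a above in auto)
    finally show ?case using pot step.IH[OF a(1) below] by linarith
  qed
  \<comment> \<open>Any exponent that covers \<open>q n\<close> works here; the remaining potential
    is nonnegative and is dropped.\<close>
  have "12 + q n < 2 ^ (12 + q n)" by (rule less_exp)
  then have "q n \<le> 2 ^ (12 + q n)" by linarith
  moreover have "q k \<le> q n" if "k \<le> n" for k using q(1) that by (simp add: strict_mono_less_eq)
  ultimately have "(\<Sum>k\<in>{K<..n}. C k) + c (12 + q n) * M n / 3 \<le> c 12 * M K / 3"
    by (intro potential n) (auto intro: order_trans)
  moreover have "0 \<le> c (12 + q n) * M n / 3" using M0[OF n] by (simp add: c_def)
  moreover have "c 12 * M K / 3 = 21 / 12 * M K / 4096" by (simp add: c_def)
  ultimately show ?thesis by linarith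
qed

section \<open>Small primes\<close>

definition odd_primes :: "int list" where
  "odd_primes = [
   3, 5, 7, 11, 13, 17, 19, 23, 29, 31, 37, 41, 43, 47, 53, 59, 61, 67, 71, 73, 79, 83, 89, 97,
   101, 103, 107, 109, 113, 127, 131, 137, 139, 149, 151, 157, 163, 167, 173, 179, 181, 191, 193,
   197, 199, 211, 223, 227, 229, 233, 239, 241, 251, 257, 263, 269, 271, 277, 281, 283, 293, 307,
   311, 313, 317, 331, 337, 347, 349, 353, 359, 367, 373, 379, 383, 389, 397, 401, 409, 419, 421,
   431, 433, 439, 443, 449, 457, 461, 463, 467, 479, 487, 491, 499, 503, 509, 521, 523, 541, 547,
   557, 563, 569, 571, 577, 587, 593, 599, 601, 607, 613, 617, 619, 631, 641, 643, 647, 653, 659,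
   661, 673, 677, 683, 691, 701, 709, 719, 727, 733, 739, 743, 751, 757, 761, 769, 773, 787, 797,
   809, 811, 821, 823, 827, 829, 839, 853, 857, 859, 863, 877, 881, 883, 887, 907, 911, 919, 929,
   937, 941, 947, 953, 967, 971, 977, 983, 991, 997, 1009, 1013, 1019, 1021, 1031, 1033, 1039,
   1049, 1051, 1061, 1063, 1069, 1087, 1091, 1093, 1097, 1103, 1109, 1117, 1123, 1129, 1151,
   1153, 1163, 1171, 1181, 1187, 1193, 1201, 1213, 1217, 1223, 1229, 1231, 1237, 1249, 1259,
   1277, 1279, 1283, 1289, 1291, 1297, 1301, 1303, 1307, 1319, 1321, 1327, 1361, 1367, 1373,
   1381, 1399, 1409, 1423, 1427, 1429, 1433, 1439, 1447, 1451, 1453, 1459, 1471, 1481, 1483,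
   1487, 1489, 1493, 1499, 1511, 1523, 1531, 1543, 1549, 1553, 1559, 1567, 1571, 1579, 1583,
   1597, 1601, 1607, 1609, 1613, 1619, 1621, 1627, 1637, 1657, 1663, 1667, 1669, 1693, 1697,
   1699, 1709, 1721, 1723, 1733, 1741, 1747, 1753, 1759, 1777, 1783, 1787, 1789, 1801, 1811,
   1823, 1831, 1847, 1861, 1867, 1871, 1873, 1877, 1879, 1889, 1901, 1907, 1913, 1931, 1933,
   1949, 1951, 1973, 1979, 1987, 1993, 1997, 1999, 2003, 2011, 2017, 2027, 2029, 2039, 2053,
   2063, 2069, 2081, 2083, 2087, 2089, 2099, 2111, 2113, 2129, 2131, 2137, 2141, 2143, 2153,
   2161, 2179, 2203, 2207, 2213, 2221, 2237, 2239, 2243, 2251, 2267, 2269, 2273, 2281, 2287,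
   2293, 2297, 2309, 2311, 2333, 2339, 2341, 2347, 2351, 2357, 2371, 2377, 2381, 2383, 2389,
   2393, 2399, 2411, 2417, 2423, 2437, 2441, 2447, 2459, 2467, 2473, 2477, 2503, 2521, 2531,
   2539, 2543, 2549, 2551, 2557, 2579, 2591, 2593, 2609, 2617, 2621, 2633, 2647, 2657, 2659,
   2663, 2671, 2677, 2683, 2687, 2689, 2693, 2699, 2707, 2711, 2713, 2719, 2729, 2731, 2741,
   2749, 2753, 2767, 2777, 2789, 2791, 2797, 2801, 2803, 2819, 2833, 2837, 2843, 2851, 2857,
   2861, 2879, 2887, 2897, 2903, 2909, 2917, 2927, 2939, 2953, 2957, 2963, 2969, 2971, 2999,
   3001, 3011, 3019, 3023, 3037, 3041, 3049, 3061, 3067, 3079, 3083, 3089, 3109, 3119, 3121,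
   3137, 3163, 3167, 3169, 3181, 3187, 3191, 3203, 3209, 3217, 3221, 3229, 3251, 3253, 3257,
   3259, 3271, 3299, 3301, 3307, 3313, 3319, 3323, 3329, 3331, 3343, 3347, 3359, 3361, 3371,
   3373, 3389, 3391, 3407, 3413, 3433, 3449, 3457, 3461, 3463, 3467, 3469, 3491, 3499, 3511,
   3517, 3527, 3529, 3533, 3539, 3541, 3547, 3557, 3559, 3571, 3581, 3583, 3593, 3607, 3613,
   3617, 3623, 3631, 3637, 3643, 3659, 3671, 3673, 3677, 3691, 3697, 3701, 3709, 3719, 3727,
   3733, 3739, 3761, 3767, 3769, 3779, 3793, 3797, 3803, 3821, 3823, 3833, 3847, 3851, 3853,
   3863, 3877, 3881, 3889, 3907, 3911, 3917, 3919, 3923, 3929, 3931, 3943, 3947, 3967, 3989,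
   4001, 4003, 4007, 4013, 4019, 4021, 4027, 4049, 4051, 4057, 4073, 4079, 4091, 4093]"

text \<open>The odd primes below \<open>64\<close>: every odd composite below
  \<open>4096 = 64 ^ 2\<close> has a factor among them.\<close>

definition small_primes :: "int list" where
  "small_primes = [3, 5, 7, 11, 13, 17, 19, 23, 29, 31, 37, 41, 43, 47, 53, 59, 61]"

definition small_factor :: "int \<Rightarrow> bool" where
  "small_factor n \<longleftrightarrow> list_ex (\<lambda>d. n mod d = 0 \<and> d < n) small_primes"

text \<open>A computable certificate of completeness: \<open>x + 2 * j\<close> runs through the odd
  numbers strictly between consecutive entries.\<close>

fun sieved :: "int list \<Rightarrow> bool" where
  "sieved (x # y # zs) \<longleftrightarrow> x < y \<and> odd x \<and> odd y \<and>
     list_all (\<lambda>j. small_factor (x + 2 * j)) [1..(y - x) div 2 - 1] \<and> sieved (y # zs)"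
| "sieved _ \<longleftrightarrow> True"

text \<open>The sentinel \<open>4097\<close> closes the last gap, so every odd number from
  \<open>3\<close> to \<open>4096\<close> is covered.\<close>

lemma sieved_odd_primes: "sieved (odd_primes @ [4097])"
  by code_simp

abbreviation "listed \<equiv> length odd_primes"

lemma sieved_Cons: "sieved (x # xs) \<Longrightarrow> y \<in> set xs \<Longrightarrow> x < y"
  by (induction xs arbitrary: x) fastforce+

lemma sieved_nth_less: "sieved xs \<Longrightarrow> i < j \<Longrightarrow> j < length xs \<Longrightarrow> xs ! i < xs ! j"
proof (induction xs arbitrary: i j rule: sieved.induct)
  case (1 x y zs)
  then show ?case
    using sieved_Cons[of x "y # zs" "(y # zs) ! (j - 1)"] nth_mem[of "j - 1" "y # zs"]
    by (cases i; cases j) auto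
qed auto

lemma sieved_cover:
  "sieved xs \<Longrightarrow> xs \<noteq> [] \<Longrightarrow> hd xs \<le> n \<Longrightarrow> n < last xs \<Longrightarrow> odd n \<Longrightarrow> n \<in> set xs \<or> small_factor n"
proof (induction xs rule: sieved.induct)
  case (1 x y zs)
  show ?case
  proof (cases "y \<le> n")
    case True
    then show ?thesis using 1 by auto
  next
    case False
    show ?thesis
    proof (cases "n = x")
      case False
      define j where "j = (n - x) div 2"
      have "odd x" "odd y" "x < n" "n < y"
        using 1 False \<open>\<not> y \<le> n\<close> by auto
      then have "n = x + 2 * j" "j \<in> {1..(y - x) div 2 - 1}"
        using \<open>odd n\<close> unfolding j_def atLeastAtMost_iff by presburger+
      then show ?thesis using 1 by (auto simp: list_all_iff)
    qed simp
  qed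
qed auto

lemma small_factor_not_prime:
  assumes "small_factor n"
  shows "\<not> prime n"
proof
  assume n: "prime n"
  from assms obtain d where d: "d \<in> set small_primes" "n mod d = 0" "d < n"
    unfolding small_factor_def list_ex_iff by (elim bexE conjE)
  have "list_all (\<lambda>d. 1 < d) small_primes" by (simp add: small_primes_def)
  with d(1) have "1 < d" by (simp add: list_all_iff)
  moreover have "d dvd n" using d(2) by (rule mod_0_imp_dvd)
  moreover have "\<forall>m. 0 \<le> m \<and> m dvd n \<longrightarrow> m = 1 \<or> m = n"
    using n unfolding prime_int_iff by (elim conjE)
  ultimately have "d = 1 \<or> d = n" by (meson less_imp_le zero_less_one less_trans)
  with d(3) \<open>1 < d\<close> show False by linarith
qed

section \<open>Comparison of the primes with the list\<close>

text \<open>Numbered from \<open>pr 0 = 2\<close>, so that \<open>pr k\<close> is the size of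
  \<open>S k\<close>.\<close>

definition pr :: "nat \<Rightarrow> nat" where
  "pr k = enumerate {p::nat. prime p} k"

lemma prime_pr: "prime (pr k)"
  using enumerate_in_set[OF primes_infinite, of k] by (simp add: pr_def)

lemma strict_mono_pr: "strict_mono pr"
  using strict_mono_enumerate[OF primes_infinite] by (simp add: pr_def[abs_def])

lemma pr_ge_3: "0 < k \<Longrightarrow> 3 \<le> pr k"
  using strict_mono_less[OF strict_mono_pr, of 0 k] prime_ge_2_nat[OF prime_pr[of 0]] by simp

lemma pr_in_odd_primes:
  assumes "0 < k" "pr k \<le> 4096"
  shows "int (pr k) \<in> set odd_primes"
proof -
  have "odd (pr k)" using prime_odd_nat[OF prime_pr] pr_ge_3[OF assms(1)] by fastforce
  moreover have "hd (odd_primes @ [4097]) = 3" by (simp add: odd_primes_def)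
  ultimately have "int (pr k) \<in> set (odd_primes @ [4097]) \<or> small_factor (int (pr k))"
    using assms pr_ge_3 by (intro sieved_cover sieved_odd_primes) auto
  moreover have "\<not> small_factor (int (pr k))"
    using small_factor_not_prime[of "int (pr k)"] prime_pr[of k] by auto
  ultimately show ?thesis using assms by auto
qed

lemma odd_primes_nth_less: "i < j \<Longrightarrow> j < listed \<Longrightarrow> odd_primes ! i < odd_primes ! j"
  using sieved_nth_less[OF sieved_odd_primes, of i j] by (simp add: nth_append)

lemma odd_primes_nth_bounds:
  assumes "i < listed"
  shows "3 \<le> odd_primes ! i" "odd_primes ! i \<le> 4096"
proof -
  have "odd_primes ! 0 = 3" by (simp add: odd_primes_def)
  then show "3 \<le> odd_primes ! i"
    using odd_primes_nth_less[of 0 i] assms by (cases "i = 0") auto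
  show "odd_primes ! i \<le> 4096"
    using sieved_nth_less[OF sieved_odd_primes, of i listed] assms
    by (simp add: nth_append)
qed

text \<open>A prime smaller than entry \<open>i\<close> would be an earlier entry \<open>j\<close>,
  which by induction is at most \<open>pr (Suc j)\<close>, contradicting the monotonicity of
  \<open>pr\<close>.\<close>

lemma odd_primes_nth_le: "i < listed \<Longrightarrow> odd_primes ! i \<le> int (pr (Suc i))"
proof (induction i rule: less_induct)
  case (less i)
  show ?case
  proof (rule ccontr)
    assume small: "\<not> ?thesis"
    then have "int (pr (Suc i)) \<in> set odd_primes"
      using odd_primes_nth_bounds[OF less.prems] by (intro pr_in_odd_primes) auto
    then obtain j where j: "j < listed" "odd_primes ! j = int (pr (Suc i))"
      by (auto simp: in_set_conv_nth)
    then have "j < i"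
      using small odd_primes_nth_less[of i j] by (cases i j rule: linorder_cases) auto
    with less.IH[of j] j have "pr (Suc i) \<le> pr (Suc j)" by simp
    with \<open>j < i\<close> show False by (simp add: strict_mono_less_eq[OF strict_mono_pr])
  qed
qed

lemma pr_large: "listed < k \<Longrightarrow> 4096 < pr k"
proof (rule ccontr)
  assume k: "listed < k" "\<not> 4096 < pr k"
  then have "int (pr k) \<in> set odd_primes"
    by (intro pr_in_odd_primes) auto
  then obtain j where j: "j < listed" "odd_primes ! j = int (pr k)"
    by (auto simp: in_set_conv_nth)
  with odd_primes_nth_le[of j] have "pr k \<le> pr (Suc j)" by simp
  with j k show False by (simp add: strict_mono_less_eq[OF strict_mono_pr])
qed

text \<open>The listed numbers only enter as lower bounds of the primes, so they need not be shown to be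
  prime. The value at \<open>k = 0\<close> is irrelevant.\<close>

definition side :: "nat \<Rightarrow> nat" where
  "side k = (if 0 < k \<and> k \<le> listed then nat (odd_primes ! (k - 1)) else pr k) - 1"

definition cut :: "nat \<Rightarrow> nat" where
  "cut k = side k div 4"

definition wt :: "nat \<Rightarrow> real" where
  "wt k = 1 / real (side k - cut k)"

definition cost :: "nat \<Rightarrow> real" where
  "cost k = excess wt (k - 1) (cut k + 1) * wt k"

lemma side_pos: "0 < side k"
proof (cases "0 < k \<and> k \<le> listed")
  case True
  then have "k - 1 < listed" by linarith
  with True show ?thesis using odd_primes_nth_bounds(1)[of "k - 1"] by (simp add: side_def)
next
  case False
  then show ?thesis using prime_ge_2_nat[OF prime_pr[of k]] by (auto simp: side_def)
qed

lemma side_less_pr: "side k < pr k"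
proof (cases "0 < k \<and> k \<le> listed")
  case True
  then have "k - 1 < listed" by linarith
  with True show ?thesis
    using odd_primes_nth_le[of "k - 1"] odd_primes_nth_bounds(1)[of "k - 1"] by (simp add: side_def)
next
  case False
  then show ?thesis using prime_gt_0_nat[OF prime_pr[of k]] by (auto simp: side_def)
qed

lemma cut_less: "cut k < side k"
  using side_pos[of k] by (simp add: cut_def)

lemma wt_bounds: "0 \<le> wt k" "wt k \<le> 1"
  using cut_less[of k] by (auto simp: wt_def)

lemma cost_nonneg: "0 \<le> cost k"
  by (simp add: cost_def excess_nonneg wt_bounds)

lemma side_list:
  assumes "k < listed"
  defines "x \<equiv> odd_primes ! k"
  shows "wt (Suc k) = 1 / real_of_int (x - 1 - (x - 1) div 4)"
    and "cut (Suc k) + 1 = nat ((x - 1) div 4 + 1)"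
proof -
  have x: "3 \<le> x" using odd_primes_nth_bounds[OF assms(1)] by (simp add: x_def)
  have s: "int (side (Suc k)) = x - 1" using assms x by (simp add: side_def)
  then have c: "int (cut (Suc k)) = (x - 1) div 4" by (simp add: cut_def zdiv_int)
  have "int (side (Suc k) - cut (Suc k)) = x - 1 - (x - 1) div 4"
    using cut_less[of "Suc k"] s c by (simp add: of_nat_diff)
  then show "wt (Suc k) = 1 / real_of_int (x - 1 - (x - 1) div 4)"
    unfolding wt_def by (metis of_int_of_nat_eq)
  show "cut (Suc k) + 1 = nat ((x - 1) div 4 + 1)" using c by simp
qed

lemma approx_fold:
  "k \<le> listed \<Longrightarrow> approx wt cost k
    (fold advance (take k odd_primes) ([10^9, 0, 0, 0, 0, 0, 0, 0, 0, 0], 10^9, 10^9, 0))"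
proof (induction k)
  case 0
  have "10 ^ 9 * weight_at wt 0 j \<le> real_of_int ([10^9, 0, 0, 0, 0, 0, 0, 0, 0, 0] ! j)"
    if "j < 10" for j
    using that by (cases j) (auto simp: weight_at_0 nth_Cons')
  then show ?case by (simp add: approx_def)
next
  case (Suc k)
  let ?x = "odd_primes ! k"
  have k: "k < listed" using Suc.prems by simp
  have "approx wt cost (Suc k) (advance ?x
    (fold advance (take k odd_primes) ([10^9, 0, 0, 0, 0, 0, 0, 0, 0, 0], 10^9, 10^9, 0)))"
    using odd_primes_nth_bounds[OF k] side_list[OF k] k
    by (intro approx_advance Suc.IH wt_bounds) (auto simp: cost_def)
  then show ?case using k by (simp add: take_Suc_conv_app_nth)
qed

text \<open>The second moment bound \<open>859\<close> makes the tail at most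
  \<open>21 / 12 * 859 / 4096\<close>, about \<open>0.367\<close>; with \<open>0.517\<close> the
  total stays below \<open>1\<close>.\<close>

lemma fold_advance_odd_primes:
  "case fold advance odd_primes ([10^9, 0, 0, 0, 0, 0, 0, 0, 0, 0], 10^9, 10^9, 0) of
    (p, m1, m2, s) \<Rightarrow> m2 < 859 * 10^9 \<and> s < 517 * 10^6"
  by code_simp

abbreviation "growth k \<equiv> (\<Prod>i=1..k. 1 + 3 * wt i)"

lemma initial_bounds: "growth listed \<le> 859" "(\<Sum>k=1..listed. cost k) \<le> 517 / 1000"
proof -
  obtain p m1 m2 s where st: "fold advance odd_primes
      ([10^9, 0, 0, 0, 0, 0, 0, 0, 0, 0], 10^9, 10^9, 0) = (p, m1, m2, s)"
    by (metis prod_cases4)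
  have "take listed odd_primes = odd_primes" by simp
  then have "approx wt cost listed (p, m1, m2, s)"
    using approx_fold[of listed] by (simp only: st)
  moreover define g h where "g = growth listed" and "h = (\<Sum>k=1..listed. cost k)"
  ultimately have "10 ^ 9 * g \<le> real_of_int m2" "10 ^ 9 * h \<le> real_of_int s"
    by (simp_all only: approx_def prod.case g_def h_def)
  moreover have "m2 < 859 * 10 ^ 9" "s < 517 * 10 ^ 6"
    using fold_advance_odd_primes by (simp_all only: st prod.case)
  ultimately have "g \<le> 859" "h \<le> 517 / 1000" by simp_all
  then show "growth listed \<le> 859" "(\<Sum>k=1..listed. cost k) \<le> 517 / 1000"
    by (simp_all only: g_def h_def)
qed

lemma total_cost: "(\<Sum>k=1..n. cost k) < 1"
proof (cases "n \<le> listed")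
  case True
  then have "(\<Sum>k=1..n. cost k) \<le> (\<Sum>k=1..listed. cost k)"
    by (intro sum_mono2) (auto simp: cost_nonneg)
  then show ?thesis using initial_bounds(2) by linarith
next
  case False
  have growth_pos: "0 \<le> growth k" for k
    by (intro prod_nonneg) (simp add: wt_bounds)
  have growth_Suc: "growth k = growth (k - 1) + 3 * wt k * growth (k - 1)" if "listed < k" for k
    using that by (cases k) (simp_all add: algebra_simps)
  have side_k: "real (side k) = real (pr k) - 1" "0 < real (side k)" if "listed < k" for k
    using that side_pos[of k] prime_gt_0_nat[OF prime_pr[of k]] by (auto simp: side_def of_nat_diff)
  \<comment> \<open>The two effects of rounding in \<open>cut\<close>: the first turns the
    second-moment bound into \<open>growth (k - 1) / side k\<close>, the second gives
    \<open>3 * wt k \<le> 4 / (pr k - 1)\<close>.\<close>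
  have side_cut: "real (side k) \<le> 4 * real (cut k + 1)" "3 / 4 * real (side k) \<le> real (side k - cut k)" for k
    using cut_less[of k] by (auto simp: cut_def of_nat_diff)
  have tail: "(\<Sum>k\<in>{listed<..n}. cost k) \<le> 21 / 12 * growth listed / 4096"
  proof (rule tail_bound[OF strict_mono_pr prime_pr pr_large])
    show "growth k \<le> growth (Suc k)" for k
      using growth_pos[of k] wt_bounds[of "Suc k"] by (simp add: mult_le_cancel_left1 algebra_simps)
    fix k :: nat assume k: "listed < k"
    have "wt k \<le> 1 / (3 / 4 * real (side k))"
      unfolding wt_def using side_cut(2)[of k] side_k(2)[OF k] by (intro divide_left_mono mult_pos_pos) auto
    then have "3 * wt k \<le> 4 / (real (pr k) - 1)"
      using side_k[OF k] by (simp add: field_simps)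
    then have "growth (k - 1) * (1 + 3 * wt k) \<le> growth (k - 1) * (1 + 4 / (real (pr k) - 1))"
      by (intro mult_left_mono growth_pos) simp
    then show "growth k \<le> growth (k - 1) * (1 + 4 / (real (pr k) - 1))"
      unfolding growth_Suc[OF k] by (simp add: algebra_simps)
    have "excess wt (k - 1) (cut k + 1) \<le> growth (k - 1) / (4 * real (cut k + 1))"
      by (intro excess_le_square wt_bounds) simp
    also have "\<dots> \<le> growth (k - 1) / real (side k)"
      using side_cut(1)[of k] side_k(2)[OF k] by (intro divide_left_mono growth_pos mult_pos_pos) auto
    finally have "cost k \<le> growth (k - 1) / real (side k) * wt k"
      unfolding cost_def by (intro mult_right_mono wt_bounds)
    \<comment> \<open>Since \<open>wt k * growth (k - 1)\<close> is a third of the increment of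
      \<open>growth\<close>, the costs take the telescoping form that \<open>tail_bound\<close>
      expects.\<close>
    also have "\<dots> = (growth k - growth (k - 1)) / (3 * (real (pr k) - 1))"
      unfolding growth_Suc[OF k] side_k(1)[OF k, symmetric] by simp
    finally show "cost k \<le> (growth k - growth (k - 1)) / (3 * (real (pr k) - 1))" .
  qed (use False growth_pos in auto)
  have "(\<Sum>k=1..n. cost k) = sum cost ({1..listed} \<union> {listed<..n})"
    using False by (intro arg_cong[of _ _ "sum cost"]) auto
  also have "\<dots> = (\<Sum>k=1..listed. cost k) + (\<Sum>k\<in>{listed<..n}. cost k)"
    by (rule sum.union_disjoint) auto
  also have "\<dots> \<le> 517 / 1000 + 21 / 12 * growth listed / 4096"
    by (rule add_mono[OF initial_bounds(2) tail])
  also have "\<dots> \<le> 517 / 1000 + 21 / 12 * 859 / 4096"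
    by (intro add_left_mono divide_right_mono mult_left_mono initial_bounds(1)) simp_all
  finally show ?thesis by simp
qed

section \<open>From avoided families to parallel hyperplanes\<close>

lemma S_eq: "S k = {1..pr k}"
  unfolding S_def nth_prime_def pr_def by simp

theorem theorem1p2:
  fixes n :: nat and H :: "(nat \<Rightarrow> nat) set set"
  assumes "n \<ge> 1"
    and "\<forall>A\<in>H. hyperplane n A \<and> fixed_coords n A \<noteq> {}"
    and "\<Union>H = Q n"
  shows "\<exists>A\<in>H. \<exists>B\<in>H. A \<noteq> B \<and> parallel n A B"
proof (rule ccontr)
  assume contra: "\<not> ?thesis"
  \<comment> \<open>\<open>a F\<close> is a point of the hyperplane with fixed coordinates
    \<open>F\<close>. Where there is none, the constant \<open>1\<close> is a dummy whose avoidance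
    does no harm.\<close>
  define a where "a F = (if \<exists>A\<in>H. fixed_coords n A = F
    then SOME y. \<exists>A\<in>H. fixed_coords n A = F \<and> y \<in> A else (\<lambda>_. 1))" for F
  have hyp: "hyperplane n A" if "A \<in> H" for A
    using assms(2) that by blast
  have S_ne: "1 \<in> S k" for k
    using prime_gt_0_nat[OF prime_pr[of k]] by (simp add: S_eq)
  have ne: "A \<noteq> {}" if A: "A \<in> H" for A
  proof -
    obtain C where C: "\<forall>k\<in>{1..n}. C k = S k \<or> (\<exists>c\<in>S k. C k = {c})" "A = PiE {1..n} C"
      using hyp[OF A] unfolding hyperplane_def by (elim exE conjE)
    have "C k \<noteq> {}" if "k \<in> {1..n}" for k using bspec[OF C(1) that] S_ne[of k] by auto
    then show ?thesis using C(2) by (simp add: PiE_eq_empty_iff)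
  qed
  have a_mem: "a (fixed_coords n A) \<in> A" if A: "A \<in> H" for A
  proof -
    have "\<exists>y. \<exists>B\<in>H. fixed_coords n B = fixed_coords n A \<and> y \<in> B"
      using A ne[OF A] by blast
    from someI_ex[OF this] have "\<exists>B\<in>H. fixed_coords n B = fixed_coords n A \<and> a (fixed_coords n A) \<in> B"
      unfolding a_def using A by auto
    \<comment> \<open>The hyperplane containing the chosen point is parallel to \<open>A\<close>,
      hence equal to it.\<close>
    then show ?thesis using contra A unfolding parallel_def by metis
  qed
  have a_S: "a {k} k \<in> S k" if k: "k \<in> {1..n}" for k
  proof (cases "\<exists>A\<in>H. fixed_coords n A = {k}")
    case True
    then obtain A where "A \<in> H" "fixed_coords n A = {k}" by blast
    then have "a {k} \<in> Q n" using a_mem[of A] assms(3) by auto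
    then show ?thesis using k by (auto simp: Q_def)
  next
    case False
    then show ?thesis using S_ne by (simp add: a_def)
  qed
  \<comment> \<open>Sides are trimmed to exactly \<open>side k\<close> values, since the listed
    numbers are only known to be lower bounds of the primes. Removing \<open>a {k} k\<close>
    disposes of hyperplanes with one fixed coordinate.\<close>
  have "\<exists>U. U \<subseteq> S k - {a {k} k} \<and> card U = side k" for k
  proof -
    have "side k \<le> card (S k - {a {k} k})"
      using side_less_pr[of k] by (auto simp: S_eq card_Diff_singleton_if)
    then show ?thesis by (meson obtain_subset_with_card_n)
  qed
  then obtain T where T: "\<And>k. T k \<subseteq> S k - {a {k} k}" "\<And>k. card (T k) = side k"
    by metis
  have fin: "finite (T k)" for k using side_pos[of k] T(2)[of k] by (metis card.infinite less_irrefl)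
  have wt_eq: "wt = (\<lambda>k. 1 / real (card (T k) - cut k))"
    by (auto simp: wt_def T(2))
  have "\<exists>x\<in>PiE {1..n} T. \<forall>k G. G \<subseteq> {1..<k} \<and> G \<noteq> {} \<and> k \<le> n \<longrightarrow>
      (\<exists>i\<in>insert k G. x i \<noteq> a (insert k G) i)"
  proof (rule avoid_families[where c = cut])
    show "cut k < card (T k)" for k using cut_less T(2) by simp
    show "(\<Sum>k=1..n. doubling_mean (\<lambda>k. 1 / real (card (T k) - cut k)) (k - 1)
        (\<lambda>u. max 0 (real u - real (cut k + 1))) 1 * (1 / real (card (T k) - cut k))) < 1"
      using total_cost[of n] unfolding cost_def excess_def wt_eq .
  qed (rule fin)
  then obtain x where x: "x \<in> PiE {1..n} T"
    and avoid: "\<forall>k G. G \<subseteq> {1..<k} \<and> G \<noteq> {} \<and> k \<le> n \<longrightarrow> (\<exists>i\<in>insert k G. x i \<noteq> a (insert k G) i)"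
    by (elim bexE)
  have "PiE {1..n} T \<subseteq> PiE {1..n} S" using T(1) by (intro PiE_mono) blast
  then have "x \<in> Q n" using x unfolding Q_def by (rule subsetD)
  then obtain A where A: "A \<in> H" "x \<in> A" using assms(3) by blast
  obtain C where C: "\<forall>k\<in>{1..n}. C k = S k \<or> (\<exists>c\<in>S k. C k = {c})" "A = PiE {1..n} C"
    using hyp[OF A(1)] unfolding hyperplane_def by (elim exE conjE)
  define F where "F = fixed_coords n A"
  have F: "F \<subseteq> {1..n}" "F \<noteq> {}" "finite F"
    using assms(2) A by (auto simp: F_def fixed_coords_def)
  \<comment> \<open>On a fixed coordinate the factor of \<open>A\<close> is a singleton, and both
    \<open>x\<close> and \<open>a F\<close> lie in \<open>A\<close>.\<close>
  have agree: "x i = a F i" if i: "i \<in> F" for i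
  proof -
    have "i \<in> {1..n}" using i F by auto
    have "(\<lambda>y. y i) ` A = C i"
      using ne[OF A(1)] \<open>i \<in> {1..n}\<close> unfolding C(2) by (simp add: image_projection_PiE)
    then have "C i \<noteq> S i" using i by (auto simp: F_def fixed_coords_def)
    then obtain c where "C i = {c}" using C(1) \<open>i \<in> {1..n}\<close> by blast
    moreover have "x i \<in> C i" "a F i \<in> C i"
      using A(2) a_mem[OF A(1)] \<open>i \<in> {1..n}\<close> unfolding C(2) F_def by (auto simp: PiE_def Pi_def)
    ultimately show ?thesis by simp
  qed
  define k where "k = Max F"
  have k: "k \<in> F" using F by (simp add: k_def)
  then have kn: "k \<in> {1..n}" using F by auto
  show False
  proof (cases "F = {k}")
    case True
    have "x k \<in> T k" using x kn by auto
    then show False using T(1)[of k] agree[OF k] True by auto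
  next
    case False
    have "F - {k} \<subseteq> {1..<k}"
    proof
      fix i assume i: "i \<in> F - {k}"
      then have "i \<le> k" using Max_ge[OF F(3), of i] by (simp add: k_def)
      moreover have "i \<in> {1..n}" using i F(1) by blast
      ultimately show "i \<in> {1..<k}" using i by auto
    qed
    moreover have "F - {k} \<noteq> {}" "insert k (F - {k}) = F" using k False by auto
    ultimately have "\<exists>i\<in>F. x i \<noteq> a F i"
      using avoid[rule_format, of "F - {k}" k] kn by simp
    then show False using agree by blast
  qed
qed

end
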